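(* Let $\mathcal F_0=(W_0,R_0)$ be the Kripke frame with $W_0=\{0,1,2,3,4\}$ and $R_0=\{(i,j)\mid 4\ge i\ge j\ge 0\}\cup\{(0,1)\}$, and let $\mathrm{Log}\,\mathcal F_0$ be its logic. Then no modal logic $\Lambda$ with $\mathrm{K4.3}\subseteq\Lambda\subseteq\mathrm{Log}\,\mathcal F_0$ has $\mathrm{LPP}(1,2)$.
   Context: Formulas. Fix a countably infinite set $\mathcal V$ of propositional variables. A literal is a variable $p$ or its negation $\neg p$. Modal formulas are built from literals and $\bot,\top$ using $\wedge,\vee,\Diamond,\Box$; negation of an arbitrary formula is defined by the duality laws, and $\varphi\to\psi$ is $\neg\varphi\vee\psi$. $\mathrm{lits}(\varphi)$ is the set of literals occurring in $\varphi$. $\varphi(\vec p,\bar r)$ means that all variables of $\varphi$ are among $\vec p,\bar r$; substitution is simultaneous with negations expanded. Logics. A modal logic is a set $\Lambda$ of formulas containing all classical tautologies and closed under modus ponens, uniform substitution and the rule: from $\varphi\leftrightarrow\psi$ infer $\Diamond\varphi\leftrightarrow\Diamond\psi$. $\Lambda\vdash\varphi$ means $\varphi\in\Lambda$. $\Lambda$ is monotone if it contains $\Diamond p\to\Diamond(p\vee q)$; $\mathrm K$ is the smallest logic containing $\Diamond p\to\Diamond(p\vee q)$, $\Diamond(p\vee q)\to\Diamond p\vee\Diamond q$ and $\Box\top$. $\mathrm{K4.3}$ is the smallest logic containing $\mathrm K$, $\Diamond\Diamond p\to\Diamond p$ and $\Diamond p\wedge\Diamond q\to\Diamond(p\wedge\Diamond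 q)\vee\Diamond(q\wedge\Diamond p)\vee\Diamond(p\wedge q)$. $\mathrm{Log}\,\mathcal F$ is the set of formulas valid in the Kripke frame $\mathcal F$ under the usual Kripke semantics ($w\vDash\Diamond\varphi$ iff $v\vDash\varphi$ for some $v$ with $w\mathrel R v$). LPP. Let $\vec p=(p_i)_{i<n'}$, $\bar r=(r_j)_{j<m'}$ be finite tuples of pairwise distinct variables. A formula $\varphi(\vec p,\bar r)$ is $\vec p$-positive if no $\neg p_i$ is in $\mathrm{lits}(\varphi)$. It is $\vec p$-monotone in $\Lambda$ if $\Lambda\vdash\varphi(\vec p,\bar r)\to\varphi(\vec p\vee\vec q,\bar r)$, where $\vec q$ is a tuple of fresh distinct variables of the same length as $\vec p$ and $\vec p\vee\vec q=(p_i\vee q_i)_{i<n'}$. For $n,m\le\omega$, a monotone logic $\Lambda$ has $\mathrm{LPP}(n,m)$ if for all finite $n'\le n$, $m'\le m$ and tuples $\vec p=(p_i)_{i<n'}$, $\bar r=(r_j)_{j<m'}$, every formula $\varphi(\vec p,\bar r)$ that is $\vec p$-monotone in $\Lambda$ is $\Lambda$-equivalent (i.e. $\Lambda\vdash\varphi\leftrightarrow\alpha$) to some $\vec p$-positive formula $\alpha(\vec p,\bar r)$. *)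

theory Defs
  imports Main "HOL-Library.Extended_Nat"
begin

section \<open>Formulas\<close>

text \<open>The countably infinite set of propositional variables is the type \<^typ>\<open>nat\<close>.\<close>

type_synonym var = nat

datatype literal = Pos var | Neg var

fun lit_var :: "literal \<Rightarrow> var" where
  "lit_var (Pos p) = p"
| "lit_var (Neg p) = p"

datatype fm =
    Lit literal
  | Bot
  | Top
  | And fm fm  (infixr "\<^bold>\<and>" 65)
  | Or fm fm  (infixr "\<^bold>\<or>" 60)
  | Dia fm  ("\<diamond>_" [70] 70)
  | Box fm  ("\<box>_" [70] 70)

abbreviation Var :: "var \<Rightarrow> fm" where
  "Var p \<equiv> Lit (Pos p)"

fun neg :: "fm \<Rightarrow> fm"  ("\<^bold>\<not>_" [70] 70) where
  "\<^bold>\<not> Lit (Pos p) = Lit (Neg p)"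
| "\<^bold>\<not> Lit (Neg p) = Lit (Pos p)"
| "\<^bold>\<not> Bot = Top"
| "\<^bold>\<not> Top = Bot"
| "\<^bold>\<not> (\<phi> \<^bold>\<and> \<psi>) = \<^bold>\<not> \<phi> \<^bold>\<or> \<^bold>\<not> \<psi>"
| "\<^bold>\<not> (\<phi> \<^bold>\<or> \<psi>) = \<^bold>\<not> \<phi> \<^bold>\<and> \<^bold>\<not> \<psi>"
| "\<^bold>\<not> \<diamond>\<phi> = \<box>(\<^bold>\<not> \<phi>)"
| "\<^bold>\<not> \<box>\<phi> = \<diamond>(\<^bold>\<not> \<phi>)"

definition Imp :: "fm \<Rightarrow> fm \<Rightarrow> fm"  (infixr "\<^bold>\<rightarrow>" 56) where
  "\<phi> \<^bold>\<rightarrow> \<psi> = \<^bold>\<not> \<phi> \<^bold>\<or> \<psi>"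

definition Iff :: "fm \<Rightarrow> fm \<Rightarrow> fm"  (infix "\<^bold>\<leftrightarrow>" 55) where
  "\<phi> \<^bold>\<leftrightarrow> \<psi> = (\<phi> \<^bold>\<rightarrow> \<psi>) \<^bold>\<and> (\<psi> \<^bold>\<rightarrow> \<phi>)"

primrec lits :: "fm \<Rightarrow> literal set" where
  "lits (Lit l) = {l}"
| "lits Bot = {}"
| "lits Top = {}"
| "lits (\<phi> \<^bold>\<and> \<psi>) = lits \<phi> \<union> lits \<psi>"
| "lits (\<phi> \<^bold>\<or> \<psi>) = lits \<phi> \<union> lits \<psi>"
| "lits (\<diamond>\<phi>) = lits \<phi>"
| "lits (\<box>\<phi>) = lits \<phi>"

definition vars :: "fm \<Rightarrow> var set" where
  "vars \<phi> = lit_var ` lits \<phi>"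

fun subst :: "(var \<Rightarrow> fm) \<Rightarrow> fm \<Rightarrow> fm" where
  "subst \<sigma> (Lit (Pos p)) = \<sigma> p"
| "subst \<sigma> (Lit (Neg p)) = \<^bold>\<not> \<sigma> p"
| "subst \<sigma> Bot = Bot"
| "subst \<sigma> Top = Top"
| "subst \<sigma> (\<phi> \<^bold>\<and> \<psi>) = subst \<sigma> \<phi> \<^bold>\<and> subst \<sigma> \<psi>"
| "subst \<sigma> (\<phi> \<^bold>\<or> \<psi>) = subst \<sigma> \<phi> \<^bold>\<or> subst \<sigma> \<psi>"
| "subst \<sigma> (\<diamond>\<phi>) = \<diamond>(subst \<sigma> \<phi>)"
| "subst \<sigma> (\<box>\<phi>) = \<box>(subst \<sigma> \<phi>)"

section \<open>Modal logics\<close>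

primrec propositional :: "fm \<Rightarrow> bool" where
  "propositional (Lit l) = True"
| "propositional Bot = True"
| "propositional Top = True"
| "propositional (\<phi> \<^bold>\<and> \<psi>) = (propositional \<phi> \<and> propositional \<psi>)"
| "propositional (\<phi> \<^bold>\<or> \<psi>) = (propositional \<phi> \<and> propositional \<psi>)"
| "propositional (\<diamond>\<phi>) = False"
| "propositional (\<box>\<phi>) = False"

text \<open>The values at \<open>\<diamond>\<close> and \<open>\<box>\<close> are irrelevant: \<open>truth\<close> is only used on
  modality-free formulas.\<close>

fun truth :: "(var \<Rightarrow> bool) \<Rightarrow> fm \<Rightarrow> bool" where
  "truth v (Lit (Pos p)) = v p"
| "truth v (Lit (Neg p)) = (\<not> v p)"
| "truth v Bot = False"
| "truth v Top = True"
| "truth v (\<phi> \<^bold>\<and> \<psi>) = (truth v \<phi> \<and> truth v \<psi>)"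
| "truth v (\<phi> \<^bold>\<or> \<psi>) = (truth v \<phi> \<or> truth v \<psi>)"
| "truth v (\<diamond>\<phi>) = undefined"
| "truth v (\<box>\<phi>) = undefined"

text \<open>Instances of tautologies by modal formulas belong to every modal logic by
  closure under substitution.\<close>

definition tautology :: "fm \<Rightarrow> bool" where
  "tautology \<phi> \<longleftrightarrow> propositional \<phi> \<and> (\<forall>v. truth v \<phi>)"

definition modal_logic :: "fm set \<Rightarrow> bool" where
  "modal_logic \<Lambda> \<longleftrightarrow>
     (\<forall>\<phi>. tautology \<phi> \<longrightarrow> \<phi> \<in> \<Lambda>) \<and>
     (\<forall>\<phi> \<psi>. \<phi> \<in> \<Lambda> \<longrightarrow> (\<phi> \<^bold>\<rightarrow> \<psi>) \<in> \<Lambda> \<longrightarrow> \<psi> \<in> \<Lambda>) \<and>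
     (\<forall>\<phi> \<sigma>. \<phi> \<in> \<Lambda> \<longrightarrow> subst \<sigma> \<phi> \<in> \<Lambda>) \<and>
     (\<forall>\<phi> \<psi>. (\<phi> \<^bold>\<leftrightarrow> \<psi>) \<in> \<Lambda> \<longrightarrow> (\<diamond>\<phi> \<^bold>\<leftrightarrow> \<diamond>\<psi>) \<in> \<Lambda>)"

text \<open>The axioms are stated for two fixed distinct variables; their other instances
  follow by substitution.\<close>

definition ax_mono :: fm where
  "ax_mono = \<diamond>(Var 0) \<^bold>\<rightarrow> \<diamond>(Var 0 \<^bold>\<or> Var 1)"

definition ax_add :: fm where
  "ax_add = \<diamond>(Var 0 \<^bold>\<or> Var 1) \<^bold>\<rightarrow> \<diamond>(Var 0) \<^bold>\<or> \<diamond>(Var 1)"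

definition ax_4 :: fm where
  "ax_4 = \<diamond>(\<diamond>(Var 0)) \<^bold>\<rightarrow> \<diamond>(Var 0)"

definition ax_3 :: fm where
  "ax_3 = \<diamond>(Var 0) \<^bold>\<and> \<diamond>(Var 1) \<^bold>\<rightarrow>
     \<diamond>(Var 0 \<^bold>\<and> \<diamond>(Var 1)) \<^bold>\<or> \<diamond>(Var 1 \<^bold>\<and> \<diamond>(Var 0)) \<^bold>\<or> \<diamond>(Var 0 \<^bold>\<and> Var 1)"

definition monotone_logic :: "fm set \<Rightarrow> bool" where
  "monotone_logic \<Lambda> \<longleftrightarrow> modal_logic \<Lambda> \<and> ax_mono \<in> \<Lambda>"

definition K :: "fm set" where
  "K = \<Inter> {\<Lambda>. modal_logic \<Lambda> \<and> {ax_mono, ax_add, \<box>Top} \<subseteq> \<Lambda>}"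

definition K43 :: "fm set" where
  "K43 = \<Inter> {\<Lambda>. modal_logic \<Lambda> \<and> K \<subseteq> \<Lambda> \<and> {ax_4, ax_3} \<subseteq> \<Lambda>}"

section \<open>Kripke semantics\<close>

fun sat :: "'w set \<Rightarrow> ('w \<times> 'w) set \<Rightarrow> (var \<Rightarrow> 'w set) \<Rightarrow> 'w \<Rightarrow> fm \<Rightarrow> bool" where
  "sat W R V w (Lit (Pos p)) = (w \<in> V p)"
| "sat W R V w (Lit (Neg p)) = (w \<notin> V p)"
| "sat W R V w Bot = False"
| "sat W R V w Top = True"
| "sat W R V w (\<phi> \<^bold>\<and> \<psi>) = (sat W R V w \<phi> \<and> sat W R V w \<psi>)"
| "sat W R V w (\<phi> \<^bold>\<or> \<psi>) = (sat W R V w \<phi> \<or> sat W R V w \<psi>)"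
| "sat W R V w (\<diamond>\<phi>) = (\<exists>v\<in>W. (w, v) \<in> R \<and> sat W R V v \<phi>)"
| "sat W R V w (\<box>\<phi>) = (\<forall>v\<in>W. (w, v) \<in> R \<longrightarrow> sat W R V v \<phi>)"

definition Log :: "'w set \<Rightarrow> ('w \<times> 'w) set \<Rightarrow> fm set" where
  "Log W R = {\<phi>. \<forall>V. (\<forall>p. V p \<subseteq> W) \<longrightarrow> (\<forall>w\<in>W. sat W R V w \<phi>)}"

definition W0 :: "nat set" where
  "W0 = {0, 1, 2, 3, 4}"

definition R0 :: "(nat \<times> nat) set" where
  "R0 = {(i, j). 4 \<ge> i \<and> i \<ge> j \<and> j \<ge> 0} \<union> {(0, 1)}"

section \<open>LPP\<close>

definition positive :: "var list \<Rightarrow> fm \<Rightarrow> bool" where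
  "positive ps \<phi> \<longleftrightarrow> (\<forall>p\<in>set ps. Neg p \<notin> lits \<phi>)"

text \<open>The substitution of \<open>p\<^sub>i \<or> q\<^sub>i\<close> for \<open>p\<^sub>i\<close>, for tuples of equal length and distinct
  \<open>p\<^sub>i\<close>.\<close>

definition join_subst :: "var list \<Rightarrow> var list \<Rightarrow> var \<Rightarrow> fm" where
  "join_subst ps qs x =
     (case map_of (zip ps qs) x of None \<Rightarrow> Var x | Some y \<Rightarrow> Var x \<^bold>\<or> Var y)"

text \<open>In a modal logic, the choice of the fresh variables \<open>qs\<close> does not matter, by
  closure under substitution.\<close>

definition monotone_in :: "fm set \<Rightarrow> var list \<Rightarrow> var list \<Rightarrow> fm \<Rightarrow> bool" where
  "monotone_in \<Lambda> ps rs \<phi> \<longleftrightarrow>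
     (\<forall>qs. length qs = length ps \<and> distinct qs \<and> set qs \<inter> (set ps \<union> set rs) = {} \<longrightarrow>
        (\<phi> \<^bold>\<rightarrow> subst (join_subst ps qs) \<phi>) \<in> \<Lambda>)"

text \<open>The notion is meant for a \<^const>\<open>monotone_logic\<close>, such as any logic that
  includes \<^const>\<open>K43\<close>; the definition itself does not impose this.\<close>

definition has_LPP :: "fm set \<Rightarrow> enat \<Rightarrow> enat \<Rightarrow> bool" where
  "has_LPP \<Lambda> n m \<longleftrightarrow>
     (\<forall>ps rs \<phi>. enat (length ps) \<le> n \<longrightarrow> enat (length rs) \<le> m \<longrightarrow> distinct (ps @ rs) \<longrightarrow>
        vars \<phi> \<subseteq> set ps \<union> set rs \<longrightarrow> monotone_in \<Lambda> ps rs \<phi> \<longrightarrow>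
        (\<exists>\<alpha>. vars \<alpha> \<subseteq> set ps \<union> set rs \<and> positive ps \<alpha> \<and> (\<phi> \<^bold>\<leftrightarrow> \<alpha>) \<in> \<Lambda>))"

end

theory Submission
  imports Defs "HOL-Library.Countable"
begin

text \<open>
  Write \<open>p\<close> for variable 0 and \<open>r\<close> for variable 1, and call a point good if it satisfies
  \<open>r \<or> p\<close> and bad otherwise. The formula \<open>witness p\<close> says that either all successors are good, or
  some successor in \<open>r \<and> p\<close> has a bad successor (\<open>ahead p\<close>), while no path leads from a bad
  successor to an \<open>r\<close>-point and on to a bad point (\<open>guarded p\<close>).

  This is monotone in \<open>p\<close> as soon as the successors of the root are weakly connected. Let \<open>x\<close> be a
  successor in \<open>r \<and> p\<close> with a bad successor, and enlarge \<open>p\<close>. If some successor \<open>y\<close> of the root is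
  still bad, then \<open>x\<close> and \<open>y\<close> are distinct because they disagree on \<open>r\<close>. If \<open>y\<close> saw \<open>x\<close>, the path
  from \<open>y\<close> through \<open>x\<close> to a bad point would have been forbidden from the start; so \<open>x\<close> sees \<open>y\<close>,
  and \<open>x\<close> is still a witness. This argument takes one instance of the axiom of weak
  connectedness and monotonicity of \<open>\<diamond>\<close>, so it can be carried out inside the logic
  (\<open>witness_monotone\<close>).

  No \<open>p\<close>-positive formula is equivalent to \<open>witness p\<close> over the frame \<open>W0\<close>, \<open>R0\<close>, because there
  are two models on this frame with a directed simulation between them: a relation with the back
  and forth conditions that preserves \<open>r\<close>, \<open>\<not> r\<close> and \<open>p\<close>, but not \<open>\<not> p\<close>. With \<open>a\<close>, \<open>b\<close> for \<open>r\<close>,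
  \<open>\<not> r\<close> and a sign for the value of \<open>p\<close>, the models are, from the root 4 down to the final cluster,
  \<open>a-, a+, b-, {b+, a-}\<close> and \<open>a-, b-, a+, {b+, a-}\<close>. The simulation relates the points
  3 and 2 crosswise, which reverses their order. The back and forth conditions survive this because
  the final cluster holds a substitute for each point that is then in the wrong place: \<open>a-\<close> in the
  first model may be related to \<open>a+\<close> in the second one, and \<open>b-\<close> to \<open>b+\<close>. Only the first root
  satisfies the formula, since \<open>a+\<close> comes before \<open>b-\<close> there and after it in the second model.
\<close>

section \<open>Propositional reasoning inside a modal logic\<close>

lemma neg_neg [simp]: "\<^bold>\<not> (\<^bold>\<not> \<phi>) = \<phi>"
  by (induction \<phi> rule: neg.induct) auto

instance literal :: countable by countable_datatype
instance fm :: countable by countable_datatype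

text \<open>
  The propositional skeleton of a formula: modal subformulas become variables. A box is the
  negation of a diamond, so it has to become a negated variable for the skeleton of \<open>\<^bold>\<not> \<phi>\<close> to be
  equivalent to the negated skeleton of \<open>\<phi>\<close>.
\<close>

fun skeleton :: "fm \<Rightarrow> fm" where
  "skeleton (Lit (Pos x)) = Var (to_nat (Var x))"
| "skeleton (Lit (Neg x)) = Lit (Neg (to_nat (Var x)))"
| "skeleton Bot = Bot"
| "skeleton Top = Top"
| "skeleton (\<phi> \<^bold>\<and> \<psi>) = skeleton \<phi> \<^bold>\<and> skeleton \<psi>"
| "skeleton (\<phi> \<^bold>\<or> \<psi>) = skeleton \<phi> \<^bold>\<or> skeleton \<psi>"
| "skeleton (\<diamond>\<phi>) = Var (to_nat (\<diamond>\<phi>))"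
| "skeleton (\<box>\<phi>) = Lit (Neg (to_nat (\<diamond>(\<^bold>\<not> \<phi>))))"

lemma subst_skeleton: "subst from_nat (skeleton \<phi>) = \<phi>"
  by (induction \<phi> rule: skeleton.induct) auto

lemma propositional_skeleton: "propositional (skeleton \<phi>)"
  by (induction \<phi> rule: skeleton.induct) auto

text \<open>
  The valuations \<open>holds v\<close> treat formulas that begin with a modality as atoms, except that they
  respect the duality of \<open>\<box>\<close> and \<open>\<diamond>\<close>.
\<close>

definition holds :: "(var \<Rightarrow> bool) \<Rightarrow> fm \<Rightarrow> bool" where
  "holds v \<phi> = truth v (skeleton \<phi>)"

lemma holds_neg: "holds v (\<^bold>\<not> \<phi>) = (\<not> holds v \<phi>)"
  unfolding holds_def by (induction \<phi> rule: neg.induct) auto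

lemma holds_simps:
  "\<not> holds v Bot" "holds v Top"
  "holds v (\<phi> \<^bold>\<and> \<psi>) = (holds v \<phi> \<and> holds v \<psi>)"
  "holds v (\<phi> \<^bold>\<or> \<psi>) = (holds v \<phi> \<or> holds v \<psi>)"
  "holds v (\<^bold>\<not> \<phi>) = (\<not> holds v \<phi>)"
  "holds v (\<phi> \<^bold>\<rightarrow> \<psi>) = (holds v \<phi> \<longrightarrow> holds v \<psi>)"
  "holds v (\<phi> \<^bold>\<leftrightarrow> \<psi>) = (holds v \<phi> = holds v \<psi>)"
  "holds v (Lit (Neg x)) = (\<not> holds v (Var x))"
  "holds v (\<box>\<phi>) = (\<not> holds v (\<diamond>(\<^bold>\<not> \<phi>)))"
  by (auto simp: holds_def Imp_def Iff_def holds_neg[unfolded holds_def])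

text \<open>
  A formula that holds for Boolean reasons alone is a substitution instance of its skeleton, which
  is a tautology.
\<close>

lemma boolean_valid_in_logic:
  assumes "modal_logic \<Lambda>" and "\<And>v. holds v \<phi>"
  shows "\<phi> \<in> \<Lambda>"
proof -
  have "tautology (skeleton \<phi>)"
    using assms(2) by (simp add: tautology_def propositional_skeleton holds_def)
  then have "subst from_nat (skeleton \<phi>) \<in> \<Lambda>"
    using assms(1) unfolding modal_logic_def by blast
  then show ?thesis by (simp add: subst_skeleton)
qed

lemma boolean_consequence_in_logic:
  assumes logic: "modal_logic \<Lambda>" and "set \<Gamma> \<subseteq> \<Lambda>"
    and "\<And>v. \<forall>\<psi>\<in>set \<Gamma>. holds v \<psi> \<Longrightarrow> holds v \<phi>"
  shows "\<phi> \<in> \<Lambda>"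
  using assms(2,3)
proof (induction \<Gamma> arbitrary: \<phi>)
  case Nil
  show ?case by (rule boolean_valid_in_logic[OF logic]) (simp add: Nil.prems(2))
next
  case (Cons \<psi> \<Gamma>)
  have "(\<psi> \<^bold>\<rightarrow> \<phi>) \<in> \<Lambda>"
  proof (rule Cons.IH)
    show "set \<Gamma> \<subseteq> \<Lambda>" using Cons.prems(1) by simp
    show "holds v (\<psi> \<^bold>\<rightarrow> \<phi>)" if "\<forall>\<chi>\<in>set \<Gamma>. holds v \<chi>" for v
      using that Cons.prems(2)[of v] by (simp add: holds_simps)
  qed
  moreover have "\<psi> \<in> \<Lambda>" using Cons.prems(1) by simp
  ultimately show ?case
    using logic unfolding modal_logic_def by blast
qed

section \<open>Modal reasoning in monotone and weakly connected logics\<close>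

lemma subst_in_logic: "modal_logic \<Lambda> \<Longrightarrow> \<phi> \<in> \<Lambda> \<Longrightarrow> subst \<sigma> \<phi> \<in> \<Lambda>"
  unfolding modal_logic_def by blast

lemma Dia_mono:
  assumes logic: "modal_logic \<Lambda>" and "ax_mono \<in> \<Lambda>" and "(\<phi> \<^bold>\<rightarrow> \<psi>) \<in> \<Lambda>"
  shows "(\<diamond>\<phi> \<^bold>\<rightarrow> \<diamond>\<psi>) \<in> \<Lambda>"
proof -
  have "(\<phi> \<^bold>\<or> \<psi> \<^bold>\<leftrightarrow> \<psi>) \<in> \<Lambda>"
    by (rule boolean_consequence_in_logic[OF logic, where \<Gamma> = "[\<phi> \<^bold>\<rightarrow> \<psi>]"])
      (use assms(3) in \<open>auto simp: holds_simps\<close>)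
  then have iff: "(\<diamond>(\<phi> \<^bold>\<or> \<psi>) \<^bold>\<leftrightarrow> \<diamond>\<psi>) \<in> \<Lambda>"
    using logic unfolding modal_logic_def by blast
  have inst: "(\<diamond>\<phi> \<^bold>\<rightarrow> \<diamond>(\<phi> \<^bold>\<or> \<psi>)) \<in> \<Lambda>"
    using subst_in_logic[OF logic assms(2), of "\<lambda>x. if x = 0 then \<phi> else \<psi>"]
    by (simp add: ax_mono_def Imp_def)
  show ?thesis
    by (rule boolean_consequence_in_logic[OF logic,
          where \<Gamma> = "[\<diamond>(\<phi> \<^bold>\<or> \<psi>) \<^bold>\<leftrightarrow> \<diamond>\<psi>, \<diamond>\<phi> \<^bold>\<rightarrow> \<diamond>(\<phi> \<^bold>\<or> \<psi>)]"])
      (use iff inst in \<open>auto simp: holds_simps\<close>)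
qed

lemma Box_mono:
  assumes logic: "modal_logic \<Lambda>" and "ax_mono \<in> \<Lambda>" and "(\<phi> \<^bold>\<rightarrow> \<psi>) \<in> \<Lambda>"
  shows "(\<box>\<phi> \<^bold>\<rightarrow> \<box>\<psi>) \<in> \<Lambda>"
proof -
  have "(\<^bold>\<not> \<psi> \<^bold>\<rightarrow> \<^bold>\<not> \<phi>) \<in> \<Lambda>"
    by (rule boolean_consequence_in_logic[OF logic, where \<Gamma> = "[\<phi> \<^bold>\<rightarrow> \<psi>]"])
      (use assms(3) in \<open>auto simp: holds_simps\<close>)
  then have *: "(\<diamond>(\<^bold>\<not> \<psi>) \<^bold>\<rightarrow> \<diamond>(\<^bold>\<not> \<phi>)) \<in> \<Lambda>"
    using Dia_mono[OF assms(1,2)] by blast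
  show ?thesis
    by (rule boolean_consequence_in_logic[OF logic, where \<Gamma> = "[\<diamond>(\<^bold>\<not> \<psi>) \<^bold>\<rightarrow> \<diamond>(\<^bold>\<not> \<phi>)]"])
      (use * in \<open>auto simp: holds_simps\<close>)
qed

lemma weakly_connected_instance:
  assumes "modal_logic \<Lambda>" and "ax_3 \<in> \<Lambda>"
  shows "(\<diamond>\<phi> \<^bold>\<and> \<diamond>\<psi> \<^bold>\<rightarrow> \<diamond>(\<phi> \<^bold>\<and> \<diamond>\<psi>) \<^bold>\<or> \<diamond>(\<psi> \<^bold>\<and> \<diamond>\<phi>) \<^bold>\<or> \<diamond>(\<phi> \<^bold>\<and> \<psi>)) \<in> \<Lambda>"
  using subst_in_logic[OF assms, of "\<lambda>x. if x = 0 then \<phi> else \<psi>"]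
  by (simp add: ax_3_def Imp_def)

section \<open>A monotone formula\<close>

abbreviation good :: "fm \<Rightarrow> fm" where
  "good p \<equiv> Var 1 \<^bold>\<or> p"

definition guarded :: "fm \<Rightarrow> fm" where
  "guarded p = \<box>(good p \<^bold>\<or> \<box>(Lit (Neg 1) \<^bold>\<or> \<box>(good p)))"

definition ahead :: "fm \<Rightarrow> fm" where
  "ahead p = \<diamond>((Var 1 \<^bold>\<and> p) \<^bold>\<and> \<diamond>(\<^bold>\<not> (good p)))"

definition witness :: "fm \<Rightarrow> fm" where
  "witness p = (ahead p \<^bold>\<and> guarded p) \<^bold>\<or> \<box>(good p)"

lemma guarded_mono:
  assumes "modal_logic \<Lambda>" and "ax_mono \<in> \<Lambda>" and "(p \<^bold>\<rightarrow> p') \<in> \<Lambda>"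
  shows "(guarded p \<^bold>\<rightarrow> guarded p') \<in> \<Lambda>"
proof -
  note box = Box_mono[OF assms(1,2)] and taut = boolean_consequence_in_logic[OF assms(1)]
  have good: "(good p \<^bold>\<rightarrow> good p') \<in> \<Lambda>"
    by (rule taut[where \<Gamma> = "[p \<^bold>\<rightarrow> p']"])
      (use assms(3) in \<open>auto simp: holds_simps\<close>)
  have inner: "((Lit (Neg 1) \<^bold>\<or> \<box>(good p)) \<^bold>\<rightarrow> (Lit (Neg 1) \<^bold>\<or> \<box>(good p'))) \<in> \<Lambda>"
    by (rule taut[where \<Gamma> = "[\<box>(good p) \<^bold>\<rightarrow> \<box>(good p')]"])
      (use box[OF good] in \<open>auto simp: holds_simps\<close>)
  have "((good p \<^bold>\<or> \<box>(Lit (Neg 1) \<^bold>\<or> \<box>(good p))) \<^bold>\<rightarrow>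
         (good p' \<^bold>\<or> \<box>(Lit (Neg 1) \<^bold>\<or> \<box>(good p')))) \<in> \<Lambda>"
    by (rule taut[where \<Gamma> = "[good p \<^bold>\<rightarrow> good p',
            \<box>(Lit (Neg 1) \<^bold>\<or> \<box>(good p)) \<^bold>\<rightarrow> \<box>(Lit (Neg 1) \<^bold>\<or> \<box>(good p'))]"])
      (use good box[OF inner] in \<open>auto simp: holds_simps\<close>)
  then show ?thesis
    unfolding guarded_def by (rule box)
qed

text \<open>
  The heart of the monotonicity argument: a point \<open>x\<close> that witnesses \<open>ahead p\<close> is compared with a
  point \<open>y\<close> that is bad even for the larger \<open>p'\<close>. The three cases of weak connectedness give
  \<open>ahead p'\<close>, a violation of \<open>guarded p\<close>, and a contradiction, respectively.
\<close>

lemma ahead_mono: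
  assumes "modal_logic \<Lambda>" and "ax_mono \<in> \<Lambda>" and "ax_3 \<in> \<Lambda>" and "(p \<^bold>\<rightarrow> p') \<in> \<Lambda>"
  shows "(ahead p \<^bold>\<and> guarded p \<^bold>\<rightarrow> ahead p' \<^bold>\<or> \<box>(good p')) \<in> \<Lambda>"
proof -
  note dia = Dia_mono[OF assms(1,2)] and taut = boolean_consequence_in_logic[OF assms(1)]
  let ?x = "(Var 1 \<^bold>\<and> p) \<^bold>\<and> \<diamond>(\<^bold>\<not> (good p))" and ?y = "\<^bold>\<not> (good p')"
  let ?x' = "(Var 1 \<^bold>\<and> p') \<^bold>\<and> \<diamond>?y" and ?z = "Var 1 \<^bold>\<and> \<diamond>(\<^bold>\<not> (good p))"
  have x_sees_y: "(?x \<^bold>\<and> \<diamond>?y \<^bold>\<rightarrow> ?x') \<in> \<Lambda>"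
    by (rule taut[where \<Gamma> = "[p \<^bold>\<rightarrow> p']"])
      (use assms(4) in \<open>auto simp: holds_simps\<close>)
  have "(?x \<^bold>\<rightarrow> ?z) \<in> \<Lambda>"
    by (rule taut[where \<Gamma> = "[]"])
      (auto simp: holds_simps)
  then have "(\<diamond>?x \<^bold>\<rightarrow> \<diamond>?z) \<in> \<Lambda>"
    by (rule dia)
  then have y_sees_x: "(?y \<^bold>\<and> \<diamond>?x \<^bold>\<rightarrow> \<^bold>\<not> (good p) \<^bold>\<and> \<diamond>?z) \<in> \<Lambda>"
    by (intro taut[where \<Gamma> = "[\<diamond>?x \<^bold>\<rightarrow> \<diamond>?z, p \<^bold>\<rightarrow> p']"])
      (use assms(4) in \<open>auto simp: holds_simps\<close>)
  have x_eq_y: "(?x \<^bold>\<and> ?y \<^bold>\<rightarrow> ?x') \<in> \<Lambda>"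
    by (rule taut[where \<Gamma> = "[]"])
      (auto simp: holds_simps)
  have guarded_neg: "guarded p = \<^bold>\<not> (\<diamond>(\<^bold>\<not> (good p) \<^bold>\<and> \<diamond>?z))"
    and box_neg: "\<box>(good p') = \<^bold>\<not> (\<diamond>?y)"
    by (simp_all add: guarded_def)
  show ?thesis
    unfolding ahead_def guarded_neg box_neg
    by (rule taut[where \<Gamma> = "[\<diamond>?x \<^bold>\<and> \<diamond>?y \<^bold>\<rightarrow> \<diamond>(?x \<^bold>\<and> \<diamond>?y) \<^bold>\<or> \<diamond>(?y \<^bold>\<and> \<diamond>?x) \<^bold>\<or> \<diamond>(?x \<^bold>\<and> ?y),
            \<diamond>(?x \<^bold>\<and> \<diamond>?y) \<^bold>\<rightarrow> \<diamond>?x', \<diamond>(?y \<^bold>\<and> \<diamond>?x) \<^bold>\<rightarrow> \<diamond>(\<^bold>\<not> (good p) \<^bold>\<and> \<diamond>?z),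
            \<diamond>(?x \<^bold>\<and> ?y) \<^bold>\<rightarrow> \<diamond>?x']"])
      (use weakly_connected_instance[OF assms(1,3)] dia[OF x_sees_y] dia[OF y_sees_x]
          dia[OF x_eq_y]
        in \<open>auto simp: holds_simps\<close>)
qed

lemma witness_mono:
  assumes "modal_logic \<Lambda>" and "ax_mono \<in> \<Lambda>" and "ax_3 \<in> \<Lambda>" and "(p \<^bold>\<rightarrow> p') \<in> \<Lambda>"
  shows "(witness p \<^bold>\<rightarrow> witness p') \<in> \<Lambda>"
proof -
  note taut = boolean_consequence_in_logic[OF assms(1)]
  have "(good p \<^bold>\<rightarrow> good p') \<in> \<Lambda>"
    by (rule taut[where \<Gamma> = "[p \<^bold>\<rightarrow> p']"])
      (use assms(4) in \<open>auto simp: holds_simps\<close>)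
  then have box: "(\<box>(good p) \<^bold>\<rightarrow> \<box>(good p')) \<in> \<Lambda>"
    by (rule Box_mono[OF assms(1,2)])
  show ?thesis
    unfolding witness_def
    by (rule taut[where \<Gamma> = "[\<box>(good p) \<^bold>\<rightarrow> \<box>(good p'), guarded p \<^bold>\<rightarrow> guarded p',
            ahead p \<^bold>\<and> guarded p \<^bold>\<rightarrow> ahead p' \<^bold>\<or> \<box>(good p')]"])
      (use box guarded_mono[OF assms(1,2,4)] ahead_mono[OF assms]
        in \<open>auto simp: holds_simps\<close>)
qed

lemma witness_monotone:
  assumes "modal_logic \<Lambda>" and "ax_mono \<in> \<Lambda>" and "ax_3 \<in> \<Lambda>"
  shows "monotone_in \<Lambda> [0] [1] (witness (Var 0))"
  unfolding monotone_in_def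
proof (intro allI impI)
  fix qs :: "var list"
  assume "length qs = length [0::var] \<and> distinct qs \<and> set qs \<inter> (set [0] \<union> set [1]) = {}"
  then obtain q where qs: "qs = [q]"
    by (auto simp: length_Suc_conv)
  have "(Var 0 \<^bold>\<rightarrow> (Var 0 \<^bold>\<or> Var q)) \<in> \<Lambda>"
    by (rule boolean_valid_in_logic[OF assms(1)]) (simp add: holds_simps)
  moreover have "subst (join_subst [0] qs) (witness (Var 0)) = witness (Var 0 \<^bold>\<or> Var q)"
    by (simp add: qs witness_def ahead_def guarded_def join_subst_def)
  ultimately show "(witness (Var 0) \<^bold>\<rightarrow> subst (join_subst [0] qs) (witness (Var 0))) \<in> \<Lambda>"
    using witness_mono[OF assms] by simp
qed

lemma vars_witness: "vars (witness (Var 0)) = {0, 1}"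
  by (auto simp: vars_def witness_def ahead_def guarded_def)

section \<open>Directed simulations\<close>

text \<open>
  The clauses for \<open>\<diamond>\<close> and \<open>\<box>\<close> are preserved by the forth and the back condition, as for
  bisimulations; since formulas are in negation normal form, only the literals that may occur
  in \<open>\<alpha>\<close> have to be preserved, and those in one direction only.
\<close>

lemma directed_simulation_preserves:
  assumes forth_cond: "\<And>w w' v. (w, w') \<in> Z \<Longrightarrow> v \<in> W \<Longrightarrow> (w, v) \<in> R \<Longrightarrow>
      \<exists>v'\<in>W'. (w', v') \<in> R' \<and> (v, v') \<in> Z"
    and back_cond: "\<And>w w' v'. (w, w') \<in> Z \<Longrightarrow> v' \<in> W' \<Longrightarrow> (w', v') \<in> R' \<Longrightarrow>
      \<exists>v\<in>W. (w, v) \<in> R \<and> (v, v') \<in> Z"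
    and literals: "\<And>l w w'. l \<in> L \<Longrightarrow> (w, w') \<in> Z \<Longrightarrow>
      sat W R V w (Lit l) \<Longrightarrow> sat W' R' V' w' (Lit l)"
    and "lits \<alpha> \<subseteq> L" and "(w, w') \<in> Z" and "sat W R V w \<alpha>"
  shows "sat W' R' V' w' \<alpha>"
  using assms(4-)
proof (induction \<alpha> arbitrary: w w')
  case (Lit l)
  show ?case by (rule literals[OF _ Lit.prems(2,3)]) (use Lit.prems(1) in simp)
next
  case (Dia \<alpha>)
  then obtain v where v: "v \<in> W" "(w, v) \<in> R" "sat W R V v \<alpha>" by auto
  obtain v' where v': "v' \<in> W'" "(w', v') \<in> R'" "(v, v') \<in> Z"
    using forth_cond[OF Dia.prems(2) v(1,2)] by blast
  have "sat W' R' V' v' \<alpha>"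
    using Dia.IH[OF _ v'(3) v(3)] Dia.prems(1) by simp
  with v' show ?case by auto
next
  case (Box \<alpha>)
  have "sat W' R' V' v' \<alpha>" if v': "v' \<in> W'" "(w', v') \<in> R'" for v'
  proof -
    obtain v where v: "v \<in> W" "(w, v) \<in> R" "(v, v') \<in> Z"
      using back_cond[OF Box.prems(2) v'] by blast
    then show ?thesis
      using Box.IH[OF _ v(3)] Box.prems(1,3) by simp
  qed
  then show ?case by simp
qed auto

lemma sat_neg: "sat W R V w (\<^bold>\<not> \<phi>) = (\<not> sat W R V w \<phi>)"
  by (induction \<phi> arbitrary: w rule: neg.induct) auto

lemma sat_Iff: "sat W R V w (\<phi> \<^bold>\<leftrightarrow> \<psi>) = (sat W R V w \<phi> = sat W R V w \<psi>)"
  by (auto simp: Iff_def Imp_def sat_neg)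

section \<open>Two models on the five-point frame\<close>

definition val_before :: "var \<Rightarrow> nat set" where
  "val_before x = (if x = 0 then {1, 3} else if x = 1 then {0, 3, 4} else {})"

definition val_after :: "var \<Rightarrow> nat set" where
  "val_after x = (if x = 0 then {1, 2} else if x = 1 then {0, 2, 4} else {})"

text \<open>
  Besides the swap of 3 and 2, the pairs \<open>(0, 2)\<close> and \<open>(2, 1)\<close> provide the substitutes in the final
  cluster: 0 for 3 on the left, and 1 for 3 on the right.
\<close>

definition swap :: "(nat \<times> nat) set" where
  "swap = {(4, 4), (3, 2), (2, 3), (2, 1), (1, 1), (0, 2), (0, 0)}"

lemma R0_iff: "(i, j) \<in> R0 \<longleftrightarrow> i \<le> 4 \<and> j \<le> i \<or> i = 0 \<and> j = 1"
  by (auto simp: R0_def)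

lemma swap_forth:
  assumes "(w, w') \<in> swap" and "v \<in> W0" and "(w, v) \<in> R0"
  shows "\<exists>v'\<in>W0. (w', v') \<in> R0 \<and> (v, v') \<in> swap"
proof -
  have "\<forall>(w, w')\<in>swap. \<forall>v\<in>W0. (w, v) \<in> R0 \<longrightarrow> (\<exists>v'\<in>W0. (w', v') \<in> R0 \<and> (v, v') \<in> swap)"
    by (simp add: swap_def W0_def R0_iff)
  with assms show ?thesis by blast
qed

lemma swap_back:
  assumes "(w, w') \<in> swap" and "v' \<in> W0" and "(w', v') \<in> R0"
  shows "\<exists>v\<in>W0. (w, v) \<in> R0 \<and> (v, v') \<in> swap"
proof -
  have "\<forall>(w, w')\<in>swap. \<forall>v'\<in>W0. (w', v') \<in> R0 \<longrightarrow> (\<exists>v\<in>W0. (w, v) \<in> R0 \<and> (v, v') \<in> swap)"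
    by (simp add: swap_def W0_def R0_iff)
  with assms show ?thesis by blast
qed

lemma positive_preserved:
  assumes "vars \<alpha> \<subseteq> {0, 1}" and "positive [0] \<alpha>" and "sat W0 R0 val_before 4 \<alpha>"
  shows "sat W0 R0 val_after 4 \<alpha>"
proof (rule directed_simulation_preserves[OF swap_forth swap_back _ _ _ assms(3)])
  show "lits \<alpha> \<subseteq> {Pos 0, Pos 1, Neg 1}"
  proof
    fix l assume "l \<in> lits \<alpha>"
    then have "lit_var l \<in> {0, 1}" and "l \<noteq> Neg 0"
      using assms(1,2) by (auto simp: vars_def positive_def)
    then show "l \<in> {Pos 0, Pos 1, Neg 1}"
      by (cases l) auto
  qed
next
  fix l w w'
  assume "l \<in> {Pos 0, Pos 1, Neg 1}" "(w, w') \<in> swap" "sat W0 R0 val_before w (Lit l)"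
  then show "sat W0 R0 val_after w' (Lit l)"
    by (auto simp: swap_def val_before_def val_after_def)
qed (auto simp: swap_def)

lemma witness_before: "sat W0 R0 val_before 4 (witness (Var 0))"
  by (auto simp: witness_def ahead_def guarded_def W0_def R0_iff val_before_def)

lemma not_witness_after: "\<not> sat W0 R0 val_after 4 (witness (Var 0))"
  by (auto simp: witness_def ahead_def guarded_def W0_def R0_iff val_after_def)

section \<open>Monotonicity without positivity\<close>

theorem proposition4p7:
  fixes \<Lambda> :: "fm set"
  assumes "modal_logic \<Lambda>"
    and "K43 \<subseteq> \<Lambda>"
    and "\<Lambda> \<subseteq> Log W0 R0"
  shows "\<not> has_LPP \<Lambda> 1 2"
proof
  assume LPP: "has_LPP \<Lambda> 1 2"
  have axioms: "ax_mono \<in> \<Lambda>" "ax_3 \<in> \<Lambda>"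
    using assms(2) by (auto simp: K43_def K_def)
  have "\<exists>\<alpha>. vars \<alpha> \<subseteq> set [0] \<union> set [1] \<and> positive [0] \<alpha> \<and> (witness (Var 0) \<^bold>\<leftrightarrow> \<alpha>) \<in> \<Lambda>"
    using LPP[unfolded has_LPP_def, rule_format, of "[0]" "[1]" "witness (Var 0)"]
      witness_monotone[OF assms(1) axioms]
    by (simp add: vars_witness one_enat_def numeral_eq_enat)
  then obtain \<alpha> where \<alpha>: "vars \<alpha> \<subseteq> {0, 1}" "positive [0] \<alpha>" "(witness (Var 0) \<^bold>\<leftrightarrow> \<alpha>) \<in> \<Lambda>"
    by auto
  have "sat W0 R0 V 4 (witness (Var 0)) = sat W0 R0 V 4 \<alpha>" if "\<forall>x. V x \<subseteq> W0" for V
    using \<alpha>(3) assms(3) that by (auto simp: Log_def W0_def sat_Iff)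
  moreover have "\<forall>x. val_before x \<subseteq> W0" "\<forall>x. val_after x \<subseteq> W0"
    by (auto simp: val_before_def val_after_def W0_def)
  ultimately show False
    using positive_preserved[OF \<alpha>(1,2)] witness_before not_witness_after by simp
qed

end
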